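(* Consider the generalized Sudoku problem with data $n, \pi_1, \pi_2, \pi_3, i_1, \ldots, i_k, g_{i_1}, \ldots, g_{i_k}$ and solution set $S(n,g)$. Let $x \in S(n, g)$ and let $J$ be a $p$-$q$-rectangle for some $2 \le p \le n$ and $1 \le q \le n$ with $J \cap \{i_1, \ldots, i_k\} = \emptyset$. If $x$ is minimal on $J$, then the generalized Sudoku problem has more than one solution.
   Context: For $y \in \mathbb{Z}^s$ write $y <> \mathbf{0}$ if every component of $y$ is nonzero. Let $n \ge 2$ and $s(n) = \sum_{i=1}^{n-1} i$. The $s(n) \times n$ matrix $A(n)$ is defined inductively: $A(1)$ is the empty matrix, and $A(m) = \begin{pmatrix} \mathbf{1}_{m-1} & -U_{m-1} \\ \mathbf{0}_{s(m-1)} & A(m-1) \end{pmatrix}$, where $\mathbf{1}_{m-1}$ is the all-ones column, $U_{m-1}$ the identity matrix and $\mathbf{0}_{s(m-1)}$ the zero column of length $s(m-1)$. Let $A$ be the $(n \cdot s(n)) \times n^2$ block-diagonal matrix whose $n$ diagonal blocks all equal $A(n)$. For a permutation $\pi$ of $\{1,\ldots,n^2\}$, $A_\pi$ is the matrix whose $j$-th column is the $\pi^{-1}(j)$-th column of $A$, and the constraint sets of $\pi$ are $cs_\pi(j) = \{\pi(i) \mid (j-1)n + 1 \le i \le jn\}$, $j=1,\ldots,n$. Generalized Sudoku problem: given permutations $\pi_1, \pi_2, \pi_3$ of $\{1, \ldots, n^2\}$, an integer $0 \le k \le n^2$, an index set $\{i_1, \ldots, i_k\} \subset \{1, \ldots,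 n^2\}$ and givens $g_{i_l} \in \mathbb{Z}$ with $1 \le g_{i_l} \le n$, its solution set is $S(n,g) = \{x \in \mathbb{Z}^{n^2} \mid 1 \le x_i \le n \ (i = 1,\ldots,n^2),\ A_{\pi_r}x <> \mathbf{0}\ (r = 1,2,3),\ x_{i_l} = g_{i_l}\ (l = 1, \ldots, k)\}$. For $1 \le p, q \le n$, a set $J \subset \{1, \ldots, n^2\}$ with $p \cdot q$ elements is a $p$-$q$-rectangle if for each $r = 1,2,3$ there exist distinct indices $j_{r,1}, \ldots, j_{r,q} \in \{1, \ldots, n\}$ with $\sharp(J \cap cs_{\pi_r}(j_{r,s})) = p$ for $s = 1, \ldots, q$. A point $x \in S(n,g)$ is minimal on a $p$-$q$-rectangle $J$ if $\sharp\{x_i \mid i \in J\} = p$. *)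

theory Defs
  imports "Jordan_Normal_Form.Matrix" "HOL-Combinatorics.Permutations"
begin

text \<open>
  Rows, columns, components and constraint sets are numbered from 0, following the conventions of
  \<^theory>\<open>Jordan_Normal_Form.Matrix\<close>: the index set \<open>{1, ..., n\<^sup>2}\<close> becomes \<open>{..<n\<^sup>2}\<close> and the
  constraint sets of a permutation are numbered by \<open>{..<n}\<close>. The values of a solution still
  range over \<open>{1..n}\<close>.
\<close>

definition num_pairs :: "nat \<Rightarrow> nat" where
  "num_pairs n = (\<Sum>i = 1..n - 1. i)"

text \<open>
  The recursion starts at 1 with the matrix having no row and one column;
  the value at 0 is a dummy.
\<close>

fun diff_mat :: "nat \<Rightarrow> int mat" where
  "diff_mat 0 = 0\<^sub>m 0 0"
| "diff_mat (Suc 0) = 0\<^sub>m 0 1"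
| "diff_mat (Suc (Suc m)) =
     four_block_mat
       (mat (Suc m) 1 (\<lambda>_. 1))           (- 1\<^sub>m (Suc m))
       (0\<^sub>m (num_pairs (Suc m)) 1)        (diff_mat (Suc m))"

definition sudoku_mat :: "nat \<Rightarrow> int mat" where
  "sudoku_mat n = diag_block_mat (replicate n (diff_mat n))"

text \<open>
  The inverse is written with \<open>inv_into UNIV\<close> because the notation \<open>inv\<close> is overloaded with the
  group inverse of HOL-Algebra here.
\<close>

definition permute_cols :: "(nat \<Rightarrow> nat) \<Rightarrow> 'a mat \<Rightarrow> 'a mat" where
  "permute_cols \<pi> M = mat (dim_row M) (dim_col M) (\<lambda>(i, j). M $$ (i, inv_into UNIV \<pi> j))"

definition nowhere_zero :: "'a :: zero vec \<Rightarrow> bool" where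
  "nowhere_zero y \<longleftrightarrow> (\<forall>i < dim_vec y. y $ i \<noteq> 0)"

definition constraint_set :: "nat \<Rightarrow> (nat \<Rightarrow> nat) \<Rightarrow> nat \<Rightarrow> nat set" where
  "constraint_set n \<pi> j = {\<pi> i | i. j * n \<le> i \<and> i < (j + 1) * n}"

text \<open>
  The permutations are \<open>\<pi> 1\<close>, \<open>\<pi> 2\<close>, \<open>\<pi> 3\<close>. \<open>I\<close> is the set of positions of the givens, and
  \<open>g i\<close> is the given at position \<open>i \<in> I\<close>; values of \<open>g\<close> outside \<open>I\<close> are irrelevant.
\<close>

definition sudoku_solutions ::
  "nat \<Rightarrow> (nat \<Rightarrow> nat \<Rightarrow> nat) \<Rightarrow> nat set \<Rightarrow> (nat \<Rightarrow> int) \<Rightarrow> int vec set" where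
  "sudoku_solutions n \<pi> I g =
     {x \<in> carrier_vec (n\<^sup>2).
        (\<forall>i < n\<^sup>2. 1 \<le> x $ i \<and> x $ i \<le> int n) \<and>
        (\<forall>r \<in> {1, 2, 3}. nowhere_zero (permute_cols (\<pi> r) (sudoku_mat n) *\<^sub>v x)) \<and>
        (\<forall>i \<in> I. x $ i = g i)}"

definition rectangle ::
  "nat \<Rightarrow> (nat \<Rightarrow> nat \<Rightarrow> nat) \<Rightarrow> nat \<Rightarrow> nat \<Rightarrow> nat set \<Rightarrow> bool" where
  "rectangle n \<pi> p q J \<longleftrightarrow>
     J \<subseteq> {..<n\<^sup>2} \<and> card J = p * q \<and>
     (\<forall>r \<in> {1, 2, 3}. \<exists>j :: nat \<Rightarrow> nat.
        inj_on j {1..q} \<and> j ` {1..q} \<subseteq> {..<n} \<and>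
        (\<forall>s \<in> {1..q}. card (J \<inter> constraint_set n (\<pi> r) (j s)) = p))"

definition minimal_on :: "'a vec \<Rightarrow> nat \<Rightarrow> nat set \<Rightarrow> bool" where
  "minimal_on x p J \<longleftrightarrow> card {x $ i | i. i \<in> J} = p"

end

theory Submission
  imports Defs
begin

text \<open>
  The condition \<open>A\<^sub>\<pi> x <> 0\<close> says that \<open>x\<close> takes distinct values on each constraint set of \<open>\<pi>\<close>.
  By counting, the rectangle \<open>J\<close> is covered by the \<open>q\<close> constraint sets of \<open>\<pi>\<close> that meet it in \<open>p\<close>
  points, so every constraint set meets \<open>J\<close> either in no point or in \<open>p\<close> points. In the latter case
  minimality forces \<open>x\<close> to take each of its \<open>p\<close> values on \<open>J\<close> exactly once there. Hence
  interchanging two of these values on \<open>J\<close> yields a second solution.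
\<close>

section \<open>The difference matrix and pairwise distinct entries\<close>

lemma nowhere_zero_append_vec:
  "nowhere_zero (v @\<^sub>v w) \<longleftrightarrow> nowhere_zero v \<and> nowhere_zero w"
proof
  assume vw: "nowhere_zero (v @\<^sub>v w)"
  have "v $ i \<noteq> 0" if "i < dim_vec v" for i
    using vw that unfolding nowhere_zero_def by (auto dest: spec[of _ i])
  moreover have "w $ i \<noteq> 0" if "i < dim_vec w" for i
    using vw that unfolding nowhere_zero_def by (auto dest: spec[of _ "dim_vec v + i"])
  ultimately show "nowhere_zero v \<and> nowhere_zero w"
    by (simp add: nowhere_zero_def)
qed (auto simp: nowhere_zero_def)

lemma diff_mat_carrier: "diff_mat n \<in> carrier_mat (num_pairs n) n"
proof (induction n rule: diff_mat.induct)
  case (3 m)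
  \<comment> \<open>The sum in \<open>num_pairs\<close> stops one below its argument, so the new
    summand is \<open>Suc m\<close>, the height of the two upper blocks.\<close>
  have "num_pairs (Suc (Suc m)) = Suc m + num_pairs (Suc m)"
    by (simp add: num_pairs_def)
  then show ?case
    using four_block_carrier_mat[of "mat (Suc m) 1 (\<lambda>_. 1)" "Suc m" 1, OF _ "3.IH"] by simp
qed (auto simp: num_pairs_def)

text \<open>Each row of \<open>diff_mat n\<close> forms one difference of two entries: the upper
  blocks compare the first entry with every later one, the lower right block compares the later ones
  among themselves. The induction therefore splits off the first entry.\<close>

lemma nowhere_zero_diff_mat_iff:
  assumes "v \<in> carrier_vec n"
  shows "nowhere_zero (diff_mat n *\<^sub>v v) \<longleftrightarrow> inj_on (\<lambda>i. v $ i) {..<n}"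
  using assms
proof (induction n arbitrary: v rule: diff_mat.induct)
  case (3 m)
  define a where "a = vec_first v 1"
  define d where "d = vec_last v (Suc m)"
  have a: "a \<in> carrier_vec 1" and d: "d \<in> carrier_vec (Suc m)"
    by (auto simp: a_def d_def)
  have v: "v = a @\<^sub>v d"
    using vec_first_last_append[of v 1 "Suc m"] "3.prems" by (simp add: a_def d_def)
  have v0: "v $ 0 = a $ 0" and vS: "v $ Suc i = d $ i" if "i < Suc m" for i
    using a d that by (auto simp: v)
  have D: "diff_mat (Suc m) \<in> carrier_mat (num_pairs (Suc m)) (Suc m)"
    by (rule diff_mat_carrier)
  let ?top = "mat (Suc m) 1 (\<lambda>_. 1) *\<^sub>v a + (- 1\<^sub>m (Suc m)) *\<^sub>v d"
  have top: "?top $ i = v $ 0 - v $ Suc i" if "i < Suc m" for i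
  proof -
    have "(mat (Suc m) 1 (\<lambda>_. 1) *\<^sub>v a) $ i = a $ 0"
      using a that by (simp add: scalar_prod_def)
    moreover have "((- 1\<^sub>m (Suc m)) *\<^sub>v d) $ i = - (d $ i)"
      using d that by simp
    ultimately show ?thesis
      using a d that v0 vS by simp
  qed
  have "diff_mat (Suc (Suc m)) *\<^sub>v v = ?top @\<^sub>v
      (0\<^sub>m (num_pairs (Suc m)) 1 *\<^sub>v a + diff_mat (Suc m) *\<^sub>v d)"
    unfolding diff_mat.simps v
    by (rule four_block_mat_mult_vec[OF _ _ _ D a d]) auto
  also have "0\<^sub>m (num_pairs (Suc m)) 1 *\<^sub>v a + diff_mat (Suc m) *\<^sub>v d = diff_mat (Suc m) *\<^sub>v d"
    using a d D by auto
  finally have "nowhere_zero (diff_mat (Suc (Suc m)) *\<^sub>v v) \<longleftrightarrow>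
      nowhere_zero ?top \<and> inj_on (\<lambda>i. d $ i) {..<Suc m}"
    using "3.IH"[OF d] by (simp add: nowhere_zero_append_vec)
  moreover have "nowhere_zero ?top \<longleftrightarrow> (\<forall>i < Suc m. v $ 0 \<noteq> v $ Suc i)"
  proof -
    have "dim_vec ?top = Suc m"
      by simp
    then show ?thesis
      unfolding nowhere_zero_def using top by auto
  qed
  moreover have "inj_on (\<lambda>i. d $ i) {..<Suc m} \<longleftrightarrow> inj_on (\<lambda>i. v $ i) (Suc ` {..<Suc m})"
    by (auto simp: inj_on_def vS)
  moreover have "{..<Suc (Suc m)} = insert 0 (Suc ` {..<Suc m})"
    by (rule lessThan_Suc_eq_insert_0)
  ultimately show ?case
    by (auto simp: inj_on_insert)
\<comment> \<open>In both base cases there are no rows, and there is at most one index.\<close>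
qed (auto simp: nowhere_zero_def inj_on_def)

section \<open>Block-diagonal matrices and column permutations\<close>

lemma diag_block_mat_replicate_carrier:
  assumes "M \<in> carrier_mat r c"
  shows "diag_block_mat (replicate k M) \<in> carrier_mat (k * r) (k * c)"
  using assms by (auto simp: dim_diag_block_mat sum_list_replicate)

text \<open>The \<open>j\<close>-th block sees only the \<open>j\<close>-th segment of
  \<open>c\<close> consecutive entries of \<open>v\<close>; the induction peels off the first block
  together with its segment.\<close>

lemma nowhere_zero_diag_block_mat_replicate_iff:
  fixes M :: "'a :: comm_ring_1 mat"
  assumes M: "M \<in> carrier_mat r c" and "v \<in> carrier_vec (k * c)"
  shows "nowhere_zero (diag_block_mat (replicate k M) *\<^sub>v v) \<longleftrightarrow>
    (\<forall>j < k. nowhere_zero (M *\<^sub>v vec c (\<lambda>i. v $ (j * c + i))))"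
  using assms(2)
proof (induction k arbitrary: v)
  case 0
  then show ?case by (simp add: nowhere_zero_def)
next
  case (Suc k)
  define a where "a = vec_first v c"
  define d where "d = vec_last v (k * c)"
  have a: "a \<in> carrier_vec c" and d: "d \<in> carrier_vec (k * c)"
    by (auto simp: a_def d_def)
  have v: "v = a @\<^sub>v d"
    using vec_first_last_append[of v c "k * c"] Suc.prems by (simp add: a_def d_def)
  have B: "diag_block_mat (replicate k M) \<in> carrier_mat (k * r) (k * c)"
    using M by (rule diag_block_mat_replicate_carrier)
  have "M *\<^sub>v a + 0\<^sub>m r (k * c) *\<^sub>v d = M *\<^sub>v a"
    and "0\<^sub>m (k * r) c *\<^sub>v a + diag_block_mat (replicate k M) *\<^sub>v d =
      diag_block_mat (replicate k M) *\<^sub>v d"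
    using M B a d by auto
  then have "diag_block_mat (replicate (Suc k) M) *\<^sub>v v =
      M *\<^sub>v a @\<^sub>v diag_block_mat (replicate k M) *\<^sub>v d"
    using four_block_mat_mult_vec[OF M zero_carrier_mat zero_carrier_mat B a d] M B
    by (simp add: Let_def v)
  moreover have "vec c (\<lambda>i. v $ (0 * c + i)) = a"
    using a by (auto simp: v)
  moreover have "vec c (\<lambda>i. v $ (Suc j * c + i)) = vec c (\<lambda>i. d $ (j * c + i))" if "j < k" for j
  proof (rule eq_vecI)
    fix i assume "i < dim_vec (vec c (\<lambda>i. d $ (j * c + i)))"
    then have i: "i < c" by simp
    \<comment> \<open>The bound keeps the index inside \<open>d\<close>, where the entries of the
      appended vector are known.\<close>
    have "j * c + i < Suc j * c" using i by simp
    also have "\<dots> \<le> k * c" using that by (intro mult_le_mono1) simp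
    finally show "vec c (\<lambda>i. v $ (Suc j * c + i)) $ i = vec c (\<lambda>i. d $ (j * c + i)) $ i"
      using a d i by (simp add: v)
  qed simp
  ultimately show ?case
    using Suc.IH[OF d] by (simp add: nowhere_zero_append_vec All_less_Suc2)
qed

text \<open>Reindexing the row sums along \<open>\<pi>\<close> cancels the inverse in the matrix and
  moves the permutation to the vector.\<close>

lemma permute_cols_mult_vec:
  fixes M :: "'a :: comm_ring_1 mat"
  assumes \<pi>: "\<pi> permutes {..<c}" and M: "M \<in> carrier_mat r c" and x: "x \<in> carrier_vec c"
  shows "permute_cols \<pi> M *\<^sub>v x = M *\<^sub>v vec c (\<lambda>i. x $ \<pi> i)"
proof (rule eq_vecI)
  fix i assume "i < dim_vec (M *\<^sub>v vec c (\<lambda>i. x $ \<pi> i))"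
  then have i: "i < r" using M by simp
  have "(permute_cols \<pi> M *\<^sub>v x) $ i = (\<Sum>j<c. M $$ (i, inv_into UNIV \<pi> j) * x $ j)"
    using i M x by (simp add: permute_cols_def scalar_prod_def lessThan_atLeast0)
  also have "\<dots> = (\<Sum>j<c. M $$ (i, j) * x $ \<pi> j)"
    by (subst sum.permute[OF \<pi>]) (simp add: o_def permutes_inverses[OF \<pi>])
  also have "\<dots> = (M *\<^sub>v vec c (\<lambda>i. x $ \<pi> i)) $ i"
    using i M by (simp add: scalar_prod_def lessThan_atLeast0)
  finally show "(permute_cols \<pi> M *\<^sub>v x) $ i = (M *\<^sub>v vec c (\<lambda>i. x $ \<pi> i)) $ i" .
qed (simp add: permute_cols_def)

section \<open>Constraint sets and the matrix condition\<close>

lemma constraint_set_eq_image: "constraint_set n \<pi> j = (\<lambda>i. \<pi> (j * n + i)) ` {..<n}"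
proof -
  have "{i. j * n \<le> i \<and> i < (j + 1) * n} = (\<lambda>i. j * n + i) ` {..<n}"
    unfolding lessThan_atLeast0 image_add_atLeastLessThan by auto
  moreover have "constraint_set n \<pi> j = \<pi> ` {i. j * n \<le> i \<and> i < (j + 1) * n}"
    by (auto simp: constraint_set_def)
  ultimately show ?thesis
    by (simp add: image_image)
qed

lemma constraint_set_disjoint:
  assumes "inj \<pi>" and "i \<noteq> j"
  shows "constraint_set n \<pi> i \<inter> constraint_set n \<pi> j = {}"
proof -
  have "a = b" if "a * n \<le> k" "k < (a + 1) * n" "b * n \<le> k" "k < (b + 1) * n" for a b k
  proof -
    \<comment> \<open>Cancelling \<open>n\<close> leaves \<open>a < b + 1\<close> and
      \<open>b < a + 1\<close>.\<close>
    have "a * n < (b + 1) * n" "b * n < (a + 1) * n" using that by linarith+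
    then show ?thesis by (simp only: mult_less_cancel2) simp
  qed
  then show ?thesis
    using assms unfolding constraint_set_def by (auto dest!: injD[OF assms(1)])
qed

lemma constraint_set_subset:
  assumes "\<pi> permutes {..<n\<^sup>2}" and "j < n"
  shows "constraint_set n \<pi> j \<subseteq> {..<n\<^sup>2}"
proof -
  have "(j + 1) * n \<le> n * n" using assms(2) by (intro mult_le_mono1) simp
  then have "i < n\<^sup>2" if "i < (j + 1) * n" for i
    using that by (simp add: power2_eq_square)
  then show ?thesis
    using permutes_in_image[OF assms(1)] by (auto simp: constraint_set_def)
qed

text \<open>This is the bridge from matrices to combinatorics: the permutation is moved to the
  vector, the product is cut into blocks, and each block is read as distinctness of entries.\<close>

lemma nowhere_zero_sudoku_mat_iff:
  assumes \<pi>: "\<pi> permutes {..<n\<^sup>2}" and x: "x \<in> carrier_vec (n\<^sup>2)"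
  shows "nowhere_zero (permute_cols \<pi> (sudoku_mat n) *\<^sub>v x) \<longleftrightarrow>
    (\<forall>j < n. inj_on (\<lambda>i. x $ i) (constraint_set n \<pi> j))"
proof -
  have M: "sudoku_mat n \<in> carrier_mat (n * num_pairs n) (n\<^sup>2)"
    unfolding sudoku_mat_def power2_eq_square
    by (intro diag_block_mat_replicate_carrier diff_mat_carrier)
  have "nowhere_zero (permute_cols \<pi> (sudoku_mat n) *\<^sub>v x) \<longleftrightarrow>
      (\<forall>j < n. nowhere_zero (diff_mat n *\<^sub>v
        vec n (\<lambda>i. vec (n\<^sup>2) (\<lambda>i. x $ \<pi> i) $ (j * n + i))))"
    unfolding permute_cols_mult_vec[OF \<pi> M x] unfolding sudoku_mat_def
    by (intro nowhere_zero_diag_block_mat_replicate_iff[OF diff_mat_carrier])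
      (simp add: power2_eq_square)
  also have "\<dots> \<longleftrightarrow> (\<forall>j < n. inj_on (\<lambda>i. x $ \<pi> (j * n + i)) {..<n})"
  proof (intro all_cong1 imp_cong refl)
    fix j assume "j < n"
    have "j * n + i < n\<^sup>2" if "i < n" for i
    proof -
      have "j * n + i < (j + 1) * n" using that by simp
      also have "\<dots> \<le> n * n" using \<open>j < n\<close> by (intro mult_le_mono1) simp
      finally show ?thesis by (simp add: power2_eq_square)
    qed
    then show "nowhere_zero (diff_mat n *\<^sub>v
        vec n (\<lambda>i. vec (n\<^sup>2) (\<lambda>i. x $ \<pi> i) $ (j * n + i))) \<longleftrightarrow>
      inj_on (\<lambda>i. x $ \<pi> (j * n + i)) {..<n}"
      by (subst nowhere_zero_diff_mat_iff) (auto intro!: inj_on_cong)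
  qed
  also have "\<dots> \<longleftrightarrow> (\<forall>j < n. inj_on (\<lambda>i. x $ i) (constraint_set n \<pi> j))"
  proof -
    have "inj_on (\<lambda>i. \<pi> (j * n + i)) {..<n}" for j
      by (simp add: inj_on_def inj_eq[OF permutes_inj[OF \<pi>]])
    then show ?thesis
      by (simp add: constraint_set_eq_image comp_inj_on_iff o_def)
  qed
  finally show ?thesis .
qed

section \<open>Rectangles and the exchange of values\<close>

text \<open>The \<open>q\<close> chosen pieces are disjoint and have \<open>p\<close> points each,
  which accounts for all \<open>p * q\<close> points of \<open>J\<close>. Any other constraint set
  is disjoint from the chosen ones and so misses \<open>J\<close>.\<close>

lemma rectangle_Int_constraint_set:
  assumes J: "rectangle n \<pi> p q J" and r: "r \<in> {1, 2, 3}"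
    and \<pi>: "\<pi> r permutes {..<n\<^sup>2}"
  shows "J \<inter> constraint_set n (\<pi> r) j = {} \<or> card (J \<inter> constraint_set n (\<pi> r) j) = p"
proof -
  let ?C = "constraint_set n (\<pi> r)"
  obtain f :: "nat \<Rightarrow> nat" where f: "inj_on f {1..q}"
    and card_f: "\<And>s. s \<in> {1..q} \<Longrightarrow> card (J \<inter> ?C (f s)) = p"
    using bspec[OF J[unfolded rectangle_def, THEN conjunct2, THEN conjunct2] r] by auto
  have "finite J" and card_J: "card J = p * q"
    using J finite_subset[of J "{..<n\<^sup>2}"] by (auto simp: rectangle_def)
  have disj: "?C i \<inter> ?C k = {}" if "i \<noteq> k" for i k
    using constraint_set_disjoint[OF permutes_inj[OF \<pi>] that] .
  have "card (\<Union>s\<in>{1..q}. J \<inter> ?C (f s)) = (\<Sum>s\<in>{1..q}. card (J \<inter> ?C (f s)))"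
  proof (rule card_UN_disjoint)
    show "\<forall>s\<in>{1..q}. \<forall>t\<in>{1..q}. s \<noteq> t \<longrightarrow> J \<inter> ?C (f s) \<inter> (J \<inter> ?C (f t)) = {}"
      using disj inj_onD[OF f] by blast
  qed (use \<open>finite J\<close> in auto)
  also have "\<dots> = card J"
    using card_f by (simp add: card_J)
  finally have "(\<Union>s\<in>{1..q}. J \<inter> ?C (f s)) = J"
    using \<open>finite J\<close> by (intro card_subset_eq) auto
  then have cover: "J \<subseteq> (\<Union>s\<in>{1..q}. ?C (f s))"
    by blast
  show ?thesis
  proof (cases "j \<in> f ` {1..q}")
    case True
    then show ?thesis using card_f by auto
  next
    case False
    then have "J \<inter> ?C j = {}" using cover disj by blast
    then show ?thesis ..
  qed
qed

lemma inj_on_permute_values: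
  assumes f: "inj_on f C" and \<sigma>: "\<sigma> permutes f ` (J \<inter> C)"
  shows "inj_on (\<lambda>i. if i \<in> J then \<sigma> (f i) else f i) C"
proof -
  have "(if i \<in> J then \<sigma> (f i) else f i) = \<sigma> (f i)" if "i \<in> C" for i
  proof (cases "i \<in> J")
    case False
    then have "f i \<notin> f ` (J \<inter> C)" using f that by (auto dest: inj_onD)
    then show ?thesis using False permutes_not_in[OF \<sigma>] by simp
  qed simp
  moreover have "inj_on (\<lambda>i. \<sigma> (f i)) C"
    using f permutes_inj[OF \<sigma>] by (auto simp: inj_on_def dest: injD)
  ultimately show ?thesis
    by (simp cong: inj_on_cong)
qed

theorem theorem6p1:
  fixes n p q :: nat
    and \<pi> :: "nat \<Rightarrow> nat \<Rightarrow> nat"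
    and I J :: "nat set"
    and g :: "nat \<Rightarrow> int"
    and x :: "int vec"
  assumes "n \<ge> 2"
    and "\<forall>r \<in> {1, 2, 3}. \<pi> r permutes {..<n\<^sup>2}"
    and "I \<subseteq> {..<n\<^sup>2}"
    and "\<forall>i \<in> I. 1 \<le> g i \<and> g i \<le> int n"
    and "x \<in> sudoku_solutions n \<pi> I g"
    and "2 \<le> p" "p \<le> n"
    and "1 \<le> q" "q \<le> n"
    and "rectangle n \<pi> p q J"
    and "J \<inter> I = {}"
    and "minimal_on x p J"
  shows "\<exists>y \<in> sudoku_solutions n \<pi> I g. \<exists>z \<in> sudoku_solutions n \<pi> I g. y \<noteq> z"
proof -
  note \<pi> = assms(2) and x = assms(5) and J = assms(10)
  have xc: "x \<in> carrier_vec (n\<^sup>2)"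
    and range: "\<And>i. i < n\<^sup>2 \<Longrightarrow> 1 \<le> x $ i \<and> x $ i \<le> int n"
    and given: "\<And>i. i \<in> I \<Longrightarrow> x $ i = g i"
    using x by (auto simp: sudoku_solutions_def)
  have inj: "inj_on (\<lambda>i. x $ i) (constraint_set n (\<pi> r) j)" if "r \<in> {1, 2, 3}" "j < n" for r j
    using x that \<pi> nowhere_zero_sudoku_mat_iff[OF _ xc, of "\<pi> r"]
    by (auto simp: sudoku_solutions_def)
  have J_sub: "J \<subseteq> {..<n\<^sup>2}"
    using J by (simp add: rectangle_def)
  then have "finite J"
    using finite_subset by blast
  let ?V = "(\<lambda>i. x $ i) ` J"
  have card_V: "card ?V = p"
    using assms(12) by (simp add: minimal_on_def Setcompr_eq_image)
  \<comment> \<open>Since \<open>p\<close> is at least 2, \<open>x\<close> is not constant on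
    \<open>J\<close>; this supplies two values to interchange.\<close>
  then have "\<not> ?V \<subseteq> {x $ i}" for i
    using \<open>2 \<le> p\<close> card_mono[of "{x $ i}" ?V] by auto
  moreover have "J \<noteq> {}"
    using card_V \<open>2 \<le> p\<close> by auto
  ultimately obtain k l where kl: "k \<in> J" "l \<in> J" "x $ k \<noteq> x $ l"
    by blast
  define \<sigma> where "\<sigma> = Transposition.transpose (x $ k) (x $ l)"
  have \<sigma>: "\<sigma> permutes ?V"
    using kl unfolding \<sigma>_def by (intro permutes_swap_id) auto
  define y where "y = vec (n\<^sup>2) (\<lambda>i. if i \<in> J then \<sigma> (x $ i) else x $ i)"
  have yc: "y \<in> carrier_vec (n\<^sup>2)"
    by (simp add: y_def)
  have "inj_on (\<lambda>i. y $ i) (constraint_set n (\<pi> r) j)" if r: "r \<in> {1, 2, 3}" and j: "j < n" for r j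
  proof -
    let ?C = "constraint_set n (\<pi> r) j"
    have \<pi>r: "\<pi> r permutes {..<n\<^sup>2}"
      using \<pi> r by blast
    have "inj_on (\<lambda>i. if i \<in> J then \<sigma> (x $ i) else x $ i) ?C"
    proof (cases "J \<inter> ?C = {}")
      case True
      then have "inj_on (\<lambda>i. if i \<in> J then \<sigma> (x $ i) else x $ i) ?C \<longleftrightarrow> inj_on (\<lambda>i. x $ i) ?C"
        by (intro inj_on_cong) auto
      then show ?thesis using inj[OF r j] by simp
    next
      case False
      then have "card (J \<inter> ?C) = p"
        using rectangle_Int_constraint_set[OF J r \<pi>r, of j] by blast
      \<comment> \<open>As \<open>x\<close> is injective on \<open>?C\<close>, it takes
        \<open>p\<close> values on the intersection, hence all of \<open>?V\<close>, the set that
        \<open>\<sigma>\<close> permutes.\<close>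
      then have "card ((\<lambda>i. x $ i) ` (J \<inter> ?C)) = card ?V"
        using inj[OF r j] card_V by (simp add: card_image inj_on_subset)
      then have "(\<lambda>i. x $ i) ` (J \<inter> ?C) = ?V"
        using \<open>finite J\<close> by (intro card_subset_eq) auto
      then show ?thesis
        using inj_on_permute_values[OF inj[OF r j], of \<sigma> J] \<sigma> by simp
    qed
    moreover have "y $ i = (if i \<in> J then \<sigma> (x $ i) else x $ i)" if "i \<in> ?C" for i
      using that constraint_set_subset[OF \<pi>r j] by (auto simp: y_def)
    ultimately show ?thesis
      by (simp cong: inj_on_cong)
  qed
  moreover have "1 \<le> y $ i \<and> y $ i \<le> int n" if i: "i < n\<^sup>2" for i
  proof (cases "i \<in> J")
    case True
    \<comment> \<open>Every new value is an old value of \<open>x\<close> on \<open>J\<close>, so it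
      stays in range.\<close>
    then have "\<sigma> (x $ i) \<in> ?V"
      using permutes_in_image[OF \<sigma>] by simp
    then obtain i' where "i' \<in> J" "\<sigma> (x $ i) = x $ i'"
      by blast
    then show ?thesis
      using i True range[of i'] J_sub by (auto simp: y_def)
  next
    case False
    then show ?thesis using i range by (simp add: y_def)
  qed
  moreover have "y $ i = g i" if "i \<in> I" for i
  proof -
    have "i \<notin> J" "i < n\<^sup>2"
      using that assms(3,11) by auto
    then show ?thesis
      using given[OF that] by (simp add: y_def)
  qed
  ultimately have "y \<in> sudoku_solutions n \<pi> I g"
    using yc \<pi> nowhere_zero_sudoku_mat_iff[OF _ yc] by (auto simp: sudoku_solutions_def)
  \<comment> \<open>The entry of \<open>y\<close> at \<open>k\<close> is
    \<open>x $ l\<close>.\<close>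
  moreover have "y $ k \<noteq> x $ k"
    using kl J_sub by (auto simp: y_def \<sigma>_def)
  then have "y \<noteq> x"
    by blast
  ultimately show ?thesis
    using x by blast
qed

end
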